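(* Let $G_3$ be a Lie group with Lie algebra $\mathfrak g=\mathbb R^3\ltimes sl(2,\mathbb R)$, i.e. the real Lie algebra with basis $e_1,\dots,e_6$ and nonzero brackets (up to antisymmetry) $$[e_4,e_5]=2e_5,\ [e_4,e_6]=-2e_6,\ [e_5,e_6]=e_4,\ [e_4,e_1]=2e_1,\ [e_5,e_2]=2e_1,\ [e_6,e_1]=e_2,\ [e_4,e_3]=-2e_3,\ [e_5,e_3]=e_2,\ [e_6,e_2]=2e_3 .$$ Let $P_0=\mathrm{diag}\{1,1,1,-1,-1,-1\}$ in this basis. Then: (i) $G_3$ does not admit left-invariant symplectic structures. (ii) $G_3$ has natural left-invariant semi-para-K\"ahler structures $(\Omega_{0i},P_0,G_{0i})$, $i=1,2$, of zero scalar curvature, where $$\Omega_{01}=-e^1\wedge e^4+e^2\wedge e^5+e^3\wedge e^6,\qquad \Omega_{02}=e^1\wedge e^4-e^2\wedge e^5+e^3\wedge e^6,$$ and $G_{0i}(X,Y)=\Omega_{0i}(X,P_0Y)$. (iii) $G_3$ admits the following multiparameter families of left-invariant semi-K\"ahler 2-forms compatible with $P_0$ (the $w_{ij}$ are real parameters such that the form is nondegenerate): $$\omega_1=e^1\wedge(-w_{25}e^4+w_{15}e^5-w_{35}e^6)+e^2\wedge(w_{24}e^4+w_{25}e^5+w_{26}e^6)+e^3\wedge(w_{26}e^4+w_{35}e^5-w_{36}e^6),$$ $$\omega_2=e^1\wedge(w_{14}e^4+w_{15}e^5-w_{35}e^6)+e^2\wedge(w_{24}e^4-w_{14}e^5+w_{34}e^6)+e^3\wedge(w_{34}e^4+w_{35}e^5).$$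 Consequently, for every $\omega_i$ ($i=1,2$) in these families, $(\omega_i,P_0,g_i)$ with $g_i(X,Y)=\omega_i(X,P_0Y)$ is a left-invariant semi-para-K\"ahler structure on $G_3$, and the metric $g_i$ has zero scalar curvature.
   Context: Left-invariant tensors on a Lie group are identified with their values on the Lie algebra $\mathfrak g$. $e^1,\dots,e^6$ is the dual basis of $e_1,\dots,e_6$, and $e^i\wedge e^j=e^i\otimes e^j-e^j\otimes e^i$. The exterior derivative $d$ is that of left-invariant forms; for a 2-form, $d\omega=0$ means $\omega([X,Y],Z)-\omega([X,Z],Y)+\omega([Y,Z],X)=0$ for all $X,Y,Z\in\mathfrak g$. A left-invariant symplectic structure is a nondegenerate 2-form $\omega$ on $\mathfrak g$ with $d\omega=0$. A left-invariant paracomplex structure is an endomorphism $P$ of $\mathfrak g$ with $P^2=\mathrm{Id}$, whose $(\pm1)$-eigenspaces have equal dimension and are subalgebras. A 2-form $\omega$ is compatible with $P$ if $\omega(PX,PY)=-\omega(X,Y)$ for all $X,Y$. In dimension 6, a semi-K\"ahler 2-form is a nondegenerate left-invariant 2-form $\omega$ with $d(\omega^2)=0$, equivalently $\omega\wedge d\omega=0$. A left-invariant semi-para-K\"ahler structure is a triple $(\omega,P,g)$ where $P$ is a left-invariant (almost) paracomplex structure, $\omega$ is a semi-K\"ahler 2-form compatible with $P$, and $g(X,Y)=\omega(X,PY)$, a pseudo-Riemannian metric (a left-invariant almost para-Hermitian structure whose fundamental form satisfies $d(\omega^2)=0$). Scalar curvature is that of the Levi-Civita connection of the left-invariant pseudo-Riemannian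 metric. *)

theory Defs
  imports "HOL-Analysis.Analysis" "HOL-Combinatorics.Permutations"
begin

text \<open>
  A left-invariant tensor on a Lie group is its value on the Lie algebra, so everything below lives
  on a finite-dimensional real vector space with a Lie bracket \<open>br\<close>.
\<close>

definition lie_bracket :: "('v::real_vector \<Rightarrow> 'v \<Rightarrow> 'v) \<Rightarrow> bool" where
  "lie_bracket br \<longleftrightarrow> bilinear br \<and> (\<forall>x. br x x = 0) \<and>
     (\<forall>x y z. br x (br y z) + br y (br z x) + br z (br x y) = 0)"


section \<open>Left-invariant forms\<close>

text \<open>
  A \<open>k\<close>-form is a function of lists of vectors, of which only the values on lists of length \<open>k\<close>
  matter.
\<close>

type_synonym 'v form = "'v list \<Rightarrow> real"

definition is_form :: "nat \<Rightarrow> 'v::real_vector form \<Rightarrow> bool" where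
  "is_form k \<alpha> \<longleftrightarrow>
     (\<forall>xs i. length xs = k \<longrightarrow> i < k \<longrightarrow> linear (\<lambda>x. \<alpha> (xs[i := x]))) \<and>
     (\<forall>xs. length xs = k \<longrightarrow> \<not> distinct xs \<longrightarrow> \<alpha> xs = 0)"

text \<open>
  The factor \<open>1 / (p! q!)\<close> is the normalisation for which the wedge of two 1-forms is
  \<open>\<alpha> \<otimes> \<beta> - \<beta> \<otimes> \<alpha>\<close>, see \<open>wedge_1_1\<close>.
\<close>

definition wedge :: "nat \<Rightarrow> nat \<Rightarrow> 'v form \<Rightarrow> 'v form \<Rightarrow> 'v form" where
  "wedge p q \<alpha> \<beta> xs =
     (\<Sum>\<pi> | \<pi> permutes {..<p+q}. of_int (sign \<pi>) *
        \<alpha> (map (\<lambda>i. xs ! \<pi> i) [0..<p]) * \<beta> (map (\<lambda>i. xs ! \<pi> i) [p..<p+q]))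
     / (fact p * fact q)"

abbreviation wedge1 :: "'v form \<Rightarrow> 'v form \<Rightarrow> 'v form"  (infixl "\<and>\<^sub>1" 70) where
  "\<alpha> \<and>\<^sub>1 \<beta> \<equiv> wedge 1 1 \<alpha> \<beta>"

text \<open>
  The exterior derivative of left-invariant forms (Chevalley--Eilenberg): for constant functions
  \<open>\<alpha>(X\<^sub>1, \<dots>, X\<^sub>k)\<close> only the bracket terms of the invariant formula for \<open>d\<close> survive.
\<close>

definition ext_deriv :: "('v \<Rightarrow> 'v \<Rightarrow> 'v) \<Rightarrow> 'v form \<Rightarrow> 'v form" where
  "ext_deriv br \<alpha> xs =
     (\<Sum>j<length xs. \<Sum>i<j. (-1) ^ (i + j) * \<alpha> (br (xs ! i) (xs ! j) # nths xs (- {i, j})))"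

definition closed_form :: "nat \<Rightarrow> ('v \<Rightarrow> 'v \<Rightarrow> 'v) \<Rightarrow> 'v form \<Rightarrow> bool" where
  "closed_form k br \<alpha> \<longleftrightarrow> (\<forall>xs. length xs = Suc k \<longrightarrow> ext_deriv br \<alpha> xs = 0)"

definition nondegenerate :: "('v::real_vector \<Rightarrow> 'v \<Rightarrow> real) \<Rightarrow> bool" where
  "nondegenerate b \<longleftrightarrow> (\<forall>x. (\<forall>y. b x y = 0) \<longrightarrow> x = 0)"

definition nondeg_form :: "'v::real_vector form \<Rightarrow> bool" where
  "nondeg_form \<omega> \<longleftrightarrow> nondegenerate (\<lambda>X Y. \<omega> [X, Y])"

definition symplectic :: "('v::real_vector \<Rightarrow> 'v \<Rightarrow> 'v) \<Rightarrow> 'v form \<Rightarrow> bool" where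
  "symplectic br \<omega> \<longleftrightarrow> is_form 2 \<omega> \<and> nondeg_form \<omega> \<and> closed_form 2 br \<omega>"

text \<open>Semi-Kaehler means \<open>d(\<omega>\<^sup>n\<^sup>-\<^sup>1) = 0\<close> in dimension \<open>2n\<close>; here \<open>2n = 6\<close>.\<close>

definition semi_kahler :: "(real^6 \<Rightarrow> real^6 \<Rightarrow> real^6) \<Rightarrow> (real^6) form \<Rightarrow> bool" where
  "semi_kahler br \<omega> \<longleftrightarrow>
     is_form 2 \<omega> \<and> nondeg_form \<omega> \<and> closed_form 4 br (wedge 2 2 \<omega> \<omega>)"


section \<open>Paracomplex structures\<close>

definition almost_paracomplex :: "('v::euclidean_space \<Rightarrow> 'v) \<Rightarrow> bool" where
  "almost_paracomplex P \<longleftrightarrow>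
     linear P \<and> (\<forall>X. P (P X) = X) \<and> dim {X. P X = X} = dim {X. P X = - X}"

definition paracomplex :: "('v::euclidean_space \<Rightarrow> 'v \<Rightarrow> 'v) \<Rightarrow> ('v \<Rightarrow> 'v) \<Rightarrow> bool" where
  "paracomplex br P \<longleftrightarrow> almost_paracomplex P \<and>
     (\<forall>X Y. P X = X \<longrightarrow> P Y = Y \<longrightarrow> P (br X Y) = br X Y) \<and>
     (\<forall>X Y. P X = - X \<longrightarrow> P Y = - Y \<longrightarrow> P (br X Y) = - br X Y)"

definition compatible :: "'v form \<Rightarrow> ('v \<Rightarrow> 'v) \<Rightarrow> bool" where
  "compatible \<omega> P \<longleftrightarrow> (\<forall>X Y. \<omega> [P X, P Y] = - \<omega> [X, Y])"

definition pseudo_metric :: "('v::real_vector \<Rightarrow> 'v \<Rightarrow> real) \<Rightarrow> bool" where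
  "pseudo_metric g \<longleftrightarrow> bilinear g \<and> (\<forall>X Y. g X Y = g Y X) \<and> nondegenerate g"

definition semi_para_kahler ::
    "(real^6 \<Rightarrow> real^6 \<Rightarrow> real^6) \<Rightarrow> (real^6) form \<Rightarrow> (real^6 \<Rightarrow> real^6) \<Rightarrow>
     (real^6 \<Rightarrow> real^6 \<Rightarrow> real) \<Rightarrow> bool" where
  "semi_para_kahler br \<omega> P g \<longleftrightarrow>
     almost_paracomplex P \<and> semi_kahler br \<omega> \<and> compatible \<omega> P \<and>
     (\<forall>X Y. g X Y = \<omega> [X, P Y]) \<and> pseudo_metric g"


section \<open>Scalar curvature of a left-invariant metric\<close>

text \<open>
  On left-invariant fields \<open>g(Y, Z)\<close> is constant, so metric compatibility has no derivative term.
\<close>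

definition levi_civita ::
    "('v::real_vector \<Rightarrow> 'v \<Rightarrow> 'v) \<Rightarrow> ('v \<Rightarrow> 'v \<Rightarrow> real) \<Rightarrow> ('v \<Rightarrow> 'v \<Rightarrow> 'v) \<Rightarrow> bool" where
  "levi_civita br g D \<longleftrightarrow> bilinear D \<and>
     (\<forall>X Y. D X Y - D Y X = br X Y) \<and>
     (\<forall>X Y Z. g (D X Y) Z + g Y (D X Z) = 0)"

definition curvature ::
    "('v::real_vector \<Rightarrow> 'v \<Rightarrow> 'v) \<Rightarrow> ('v \<Rightarrow> 'v \<Rightarrow> 'v) \<Rightarrow> 'v \<Rightarrow> 'v \<Rightarrow> 'v \<Rightarrow> 'v" where
  "curvature br D X Y Z = D X (D Y Z) - D Y (D X Z) - D (br X Y) Z"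

definition ricci ::
    "(real^'n \<Rightarrow> real^'n \<Rightarrow> real^'n) \<Rightarrow> (real^'n \<Rightarrow> real^'n \<Rightarrow> real^'n) \<Rightarrow>
     real^'n \<Rightarrow> real^'n \<Rightarrow> real" where
  "ricci br D Y Z = trace (matrix (\<lambda>X. curvature br D X Y Z))"

definition gram :: "(real^'n \<Rightarrow> real^'n \<Rightarrow> real) \<Rightarrow> real^'n^'n" where
  "gram b = (\<chi> i j. b (axis i 1) (axis j 1))"

definition scalar_curvature ::
    "(real^'n \<Rightarrow> real^'n \<Rightarrow> real^'n) \<Rightarrow> (real^'n \<Rightarrow> real^'n \<Rightarrow> real) \<Rightarrow> real" where
  "scalar_curvature br g =
     (let D = (THE D. levi_civita br g D);
          ginv = matrix_inv (gram g)
      in \<Sum>i\<in>UNIV. \<Sum>j\<in>UNIV. ginv $ i $ j * ricci br D (axis i 1) (axis j 1))"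


section \<open>The Lie algebra \<open>\<real>\<^sup>3 \<ltimes> sl(2, \<real>)\<close>\<close>

text \<open>In the index type \<open>6\<close> the numeral \<open>6\<close> is \<open>0\<close>, so that \<open>1, \<dots>, 6\<close> are its six elements.\<close>

abbreviation e :: "6 \<Rightarrow> real^6" where
  "e i \<equiv> axis i 1"

definition ed :: "6 \<Rightarrow> (real^6) form" where
  "ed i xs = xs ! 0 $ i"

definition g3_table :: "6 \<Rightarrow> 6 \<Rightarrow> real^6" where
  "g3_table i j =
     (if (i, j) = (4, 5) then 2 *\<^sub>R e 5
      else if (i, j) = (4, 6) then - 2 *\<^sub>R e 6
      else if (i, j) = (5, 6) then e 4
      else if (i, j) = (4, 1) then 2 *\<^sub>R e 1
      else if (i, j) = (5, 2) then 2 *\<^sub>R e 1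
      else if (i, j) = (6, 1) then e 2
      else if (i, j) = (4, 3) then - 2 *\<^sub>R e 3
      else if (i, j) = (5, 3) then e 2
      else if (i, j) = (6, 2) then 2 *\<^sub>R e 3
      else 0)"

definition g3 :: "real^6 \<Rightarrow> real^6 \<Rightarrow> real^6" where
  "g3 X Y = (\<Sum>i\<in>UNIV. \<Sum>j\<in>UNIV. (X $ i * Y $ j) *\<^sub>R (g3_table i j - g3_table j i))"

definition P0 :: "real^6 \<Rightarrow> real^6" where
  "P0 X = (\<chi> i. (if i \<in> {1, 2, 3} then 1 else - 1) * X $ i)"

definition metric_of :: "'v form \<Rightarrow> ('v \<Rightarrow> 'v) \<Rightarrow> 'v \<Rightarrow> 'v \<Rightarrow> real" where
  "metric_of \<omega> P X Y = \<omega> [X, P Y]"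

definition Omega01 :: "(real^6) form" where
  "Omega01 xs = - (ed 1 \<and>\<^sub>1 ed 4) xs + (ed 2 \<and>\<^sub>1 ed 5) xs + (ed 3 \<and>\<^sub>1 ed 6) xs"

definition Omega02 :: "(real^6) form" where
  "Omega02 xs = (ed 1 \<and>\<^sub>1 ed 4) xs - (ed 2 \<and>\<^sub>1 ed 5) xs + (ed 3 \<and>\<^sub>1 ed 6) xs"

definition omega1 :: "real \<Rightarrow> real \<Rightarrow> real \<Rightarrow> real \<Rightarrow> real \<Rightarrow> real \<Rightarrow> (real^6) form" where
  "omega1 w15 w24 w25 w26 w35 w36 xs =
     (ed 1 \<and>\<^sub>1 (\<lambda>ys. - w25 * ed 4 ys + w15 * ed 5 ys - w35 * ed 6 ys)) xs +
     (ed 2 \<and>\<^sub>1 (\<lambda>ys. w24 * ed 4 ys + w25 * ed 5 ys + w26 * ed 6 ys)) xs +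
     (ed 3 \<and>\<^sub>1 (\<lambda>ys. w26 * ed 4 ys + w35 * ed 5 ys - w36 * ed 6 ys)) xs"

definition omega2 :: "real \<Rightarrow> real \<Rightarrow> real \<Rightarrow> real \<Rightarrow> real \<Rightarrow> (real^6) form" where
  "omega2 w14 w15 w24 w34 w35 xs =
     (ed 1 \<and>\<^sub>1 (\<lambda>ys. w14 * ed 4 ys + w15 * ed 5 ys - w35 * ed 6 ys)) xs +
     (ed 2 \<and>\<^sub>1 (\<lambda>ys. w24 * ed 4 ys - w14 * ed 5 ys + w34 * ed 6 ys)) xs +
     (ed 3 \<and>\<^sub>1 (\<lambda>ys. w34 * ed 4 ys + w35 * ed 5 ys)) xs"


section \<open>Sanity checks\<close>

lemma exhaust_6: "(i::6) \<in> {1, 2, 3, 4, 5, 6}"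
proof (induct i)
  case (of_int z)
  then have "z = 0 \<or> z = 1 \<or> z = 2 \<or> z = 3 \<or> z = 4 \<or> z = 5" by auto
  then show ?case by auto
qed

lemma UNIV_6: "(UNIV :: 6 set) = {1, 2, 3, 4, 5, 6}"
  using exhaust_6 by blast

lemma sum_6: "sum f (UNIV :: 6 set) = f 1 + f 2 + f 3 + f 4 + f 5 + f 6"
  for f :: "6 \<Rightarrow> 'a::comm_monoid_add"
  unfolding UNIV_6 by (simp add: add.assoc)

lemma forall_6: "(\<forall>i::6. Q i) \<longleftrightarrow> Q 1 \<and> Q 2 \<and> Q 3 \<and> Q 4 \<and> Q 5 \<and> Q 6"
  by (metis UNIV_6 UNIV_I insertE empty_iff)

lemma wedge_1_1: "(\<alpha> \<and>\<^sub>1 \<beta>) [X, Y] = \<alpha> [X] * \<beta> [Y] - \<alpha> [Y] * \<beta> [X]"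
proof -
  have S: "{..<1+1} = insert (0::nat) {1}" by auto
  show ?thesis
    unfolding wedge_def S
    by (subst sum_over_permutations_insert) 
       (simp_all add: sign_swap_id)
qed

lemma ext_deriv_2:
  "ext_deriv br \<omega> [X, Y, Z] = - \<omega> [br X Y, Z] + \<omega> [br X Z, Y] - \<omega> [br Y Z, X]"
  by (simp add: ext_deriv_def numeral_eq_Suc lessThan_Suc nths_Cons)

lemma g3_components:
  "g3 X Y $ 1 = 2 * (X$4 * Y$1 - X$1 * Y$4) + 2 * (X$5 * Y$2 - X$2 * Y$5)"
  "g3 X Y $ 2 = (X$6 * Y$1 - X$1 * Y$6) + (X$5 * Y$3 - X$3 * Y$5)"
  "g3 X Y $ 3 = - 2 * (X$4 * Y$3 - X$3 * Y$4) + 2 * (X$6 * Y$2 - X$2 * Y$6)"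
  "g3 X Y $ 4 = X$5 * Y$6 - X$6 * Y$5"
  "g3 X Y $ 5 = 2 * (X$4 * Y$5 - X$5 * Y$4)"
  "g3 X Y $ 6 = - 2 * (X$4 * Y$6 - X$6 * Y$4)"
  by (simp_all add: g3_def sum_6 g3_table_def axis_def algebra_simps)

lemma lie_bracket_g3: "lie_bracket g3"
  unfolding lie_bracket_def bilinear_def linear_iff vec_eq_iff forall_6
  by (simp add: g3_components algebra_simps)

lemma is_form_2:
  "is_form 2 \<omega> \<longleftrightarrow> bilinear (\<lambda>X Y. \<omega> [X, Y]) \<and> (\<forall>X. \<omega> [X, X] = 0)"
proof
  assume *: "is_form 2 \<omega>"
  have "linear (\<lambda>x. \<omega> ([Y, Y][0 := x]))" for Y
    using *[unfolded is_form_def, THEN conjunct1, rule_format, of "[Y, Y]" 0] by simp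
  moreover have "linear (\<lambda>x. \<omega> ([X, x][1 := x]))" for X
    using *[unfolded is_form_def, THEN conjunct1, rule_format, of "[X, X]" 1] by simp
  ultimately show "bilinear (\<lambda>X Y. \<omega> [X, Y]) \<and> (\<forall>X. \<omega> [X, X] = 0)"
    using * unfolding is_form_def bilinear_def by simp
next
  assume *: "bilinear (\<lambda>X Y. \<omega> [X, Y]) \<and> (\<forall>X. \<omega> [X, X] = 0)"
  show "is_form 2 \<omega>"
    unfolding is_form_def
    using * by (auto simp: bilinear_def numeral_2_eq_2 length_Suc_conv less_Suc_eq)
qed

lemma pseudo_metric_represents:
  fixes g :: "real^'n \<Rightarrow> real^'n \<Rightarrow> real"
  assumes "pseudo_metric g"
  shows "\<exists>v. \<forall>z. g v z = (\<Sum>i\<in>UNIV. z $ i * h i)"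
proof -
  have bg: "bilinear g" and nd: "nondegenerate g"
    using assms by (auto simp: pseudo_metric_def)
  have lin: "linear (\<lambda>x. g x y)" "linear (g x)" for x y
    using bg by (auto simp: bilinear_def)
  have expand: "g v z = (\<Sum>i\<in>UNIV. z $ i * g v (axis i 1))" for v z
  proof -
    have "g v z = g v (\<Sum>i\<in>UNIV. z $ i *s axis i 1)"
      by (simp add: basis_expansion)
    also have "\<dots> = (\<Sum>i\<in>UNIV. z $ i * g v (axis i 1))"
      by (simp add: linear_sum[OF lin(2)] linear_cmul[OF lin(2)] scalar_mult_eq_scaleR)
    finally show ?thesis .
  qed
  define F :: "real^'n \<Rightarrow> real^'n" where "F v = (\<chi> i. g v (axis i 1))" for v
  have "linear F"
    by (rule linearI)
       (simp_all add: F_def vec_eq_iff linear_add[OF lin(1)] linear_cmul[OF lin(1)])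
  moreover have "v = 0" if "F v = 0" for v
  proof -
    have "g v (axis i 1) = 0" for i
      using that by (simp add: F_def vec_eq_iff)
    then have "g v z = 0" for z
      by (subst expand) simp
    then show ?thesis
      using nd by (auto simp: nondegenerate_def)
  qed
  ultimately have "surj F"
    by (metis linear_injective_0 linear_injective_imp_surjective)
  then obtain v where "F v = (\<chi> i. h i)"
    by (metis surjD)
  then have "g v (axis i 1) = h i" for i
    by (simp add: F_def vec_eq_iff)
  then have "g v z = (\<Sum>i\<in>UNIV. z $ i * h i)" for z
    by (subst expand) simp
  then show ?thesis
    by blast
qed

text \<open>The description in \<open>scalar_curvature\<close> refers to a unique connection.\<close>

lemma levi_civita_ex1:
  fixes g :: "real^'n \<Rightarrow> real^'n \<Rightarrow> real"
  assumes br: "lie_bracket br" and g: "pseudo_metric g"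
  shows "\<exists>!D. levi_civita br g D"
proof (rule ex_ex1I)
  have bb: "bilinear br" and alt: "br X X = 0" for X
    using br by (auto simp: lie_bracket_def)
  have skew: "br X Y = - br Y X" for X Y
  proof -
    have "br (X + Y) (X + Y) = (br X X + br X Y) + (br Y X + br Y Y)"
      by (simp only: bilinear_ladd[OF bb] bilinear_radd[OF bb] ac_simps)
    then have "br X Y + br Y X = 0"
      by (simp only: alt add_0_left add_0_right)
    then show ?thesis
      by (simp only: eq_neg_iff_add_eq_0)
  qed
  have bg: "bilinear g" and sym: "g X Y = g Y X" and nd: "\<And>v. (\<And>z. g v z = 0) \<Longrightarrow> v = 0" for X Y
    using g by (auto simp: pseudo_metric_def nondegenerate_def)
  have eqI: "v = w" if "\<And>z. g v z = g w z" for v w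
    using nd[of "v - w"] that by (simp add: bilinear_lsub[OF bg])
  define K where "K X Y Z = (g (br X Y) Z - g (br Y Z) X + g (br Z X) Y) / 2" for X Y Z
  note bil = bilinear_ladd[OF bg] bilinear_radd[OF bg] bilinear_lmul[OF bg] bilinear_rmul[OF bg]
    bilinear_ladd[OF bb] bilinear_radd[OF bb] bilinear_lmul[OF bb] bilinear_rmul[OF bb]
  have K_lin: "linear (K X Y)" for X Y
    by (rule linearI; simp only: K_def bil; simp add: field_simps)
  have "\<exists>v. \<forall>Z. g v Z = K X Y Z" for X Y
  proof -
    have K_exp: "K X Y Z = (\<Sum>i\<in>UNIV. Z $ i * K X Y (axis i 1))" for Z
    proof -
      have "K X Y Z = K X Y (\<Sum>i\<in>UNIV. Z $ i *s axis i 1)"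
        by (simp add: basis_expansion)
      then show ?thesis
        by (simp add: linear_sum[OF K_lin] linear_cmul[OF K_lin] scalar_mult_eq_scaleR)
    qed
    obtain v where v: "\<forall>Z. g v Z = (\<Sum>i\<in>UNIV. Z $ i * K X Y (axis i 1))"
      using pseudo_metric_represents[OF g, where h = "\<lambda>i. K X Y (axis i 1)"] by blast
    have "g v Z = K X Y Z" for Z
      by (rule trans[OF v[rule_format] K_exp[symmetric]])
    then show ?thesis
      by blast
  qed
  then have ex: "\<forall>X Y. \<exists>v. \<forall>Z. g v Z = K X Y Z"
    by (intro allI)
  define D where "D X Y = (SOME v. \<forall>Z. g v Z = K X Y Z)" for X Y
  have D: "g (D X Y) Z = K X Y Z" for X Y Z
    using someI_ex[OF ex[rule_format, of X Y]] unfolding D_def by (rule spec)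
  have "bilinear D"
    unfolding bilinear_def
  proof (intro conjI allI linearI)
    show "D X (Y + Z) = D X Y + D X Z" for X Y Z
      by (rule eqI) (simp only: D K_def bil, simp add: field_simps)
    show "D X (c *\<^sub>R Y) = c *\<^sub>R D X Y" for X Y c
      by (rule eqI) (simp only: D K_def bil, simp add: field_simps)
    show "D (X + Y) Z = D X Z + D Y Z" for X Y Z
      by (rule eqI) (simp only: D K_def bil, simp add: field_simps)
    show "D (c *\<^sub>R X) Y = c *\<^sub>R D X Y" for X Y c
      by (rule eqI) (simp only: D K_def bil, simp add: field_simps)
  qed
  moreover have "D X Y - D Y X = br X Y" for X Y
  proof (rule eqI)
    fix Z
    show "g (D X Y - D Y X) Z = g (br X Y) Z"
      by (simp only: bilinear_lsub[OF bg] D K_def skew[of Y X] skew[of X Z] skew[of Y Z]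
          bilinear_lneg[OF bg]) (simp add: field_simps)
  qed
  moreover have "g (D X Y) Z + g Y (D X Z) = 0" for X Y Z
    by (simp only: sym[of Y "D X Z"] D K_def skew[of Z X] skew[of Y X] skew[of Z Y]
        bilinear_lneg[OF bg]) (simp add: field_simps)
  ultimately show "\<exists>D. levi_civita br g D"
    by (auto simp: levi_civita_def)
next
  have bg: "bilinear g" and sym: "g X Y = g Y X" and nd: "\<And>v. (\<And>z. g v z = 0) \<Longrightarrow> v = 0" for X Y
    using g by (auto simp: pseudo_metric_def nondegenerate_def)
  have koszul: "2 * g (D X Y) Z = g (br X Y) Z - g (br Y Z) X + g (br Z X) Y"
    if "levi_civita br g D" for D X Y Z
  proof -
    have t: "br A B = D A B - D B A" for A B
      using that unfolding levi_civita_def by metis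
    have m: "g (D A B) C = - g (D A C) B" for A B C
    proof -
      have "g (D A B) C + g B (D A C) = 0"
        using that unfolding levi_civita_def by blast
      then show ?thesis
        by (simp only: sym[of B "D A C"] eq_neg_iff_add_eq_0)
    qed
    show ?thesis
      using m[of X Y Z] m[of Y Z X] m[of Z X Y]
      by (simp only: t bilinear_lsub[OF bg])
  qed
  fix D D'
  assume "levi_civita br g D" "levi_civita br g D'"
  then have "g (D X Y) Z = g (D' X Y) Z" for X Y Z
    using koszul[of D X Y Z] koszul[of D' X Y Z] by simp
  then have "D X Y - D' X Y = 0" for X Y
    by (intro nd) (simp add: bilinear_lsub[OF bg])
  then show "D = D'"
    by (auto simp: fun_eq_iff)
qed

end

theory Submission
  imports Defs
begin

text \<open>
  Let \<open>A = \<real>\<^sup>3\<close> and \<open>B = sl(2, \<real>)\<close> be the eigenspaces of \<open>P\<^sub>0\<close>.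

  Not symplectic: closedness forces \<open>A\<close> to be isotropic and the pairing of \<open>A\<close> with \<open>B\<close> to be
  skew in suitable bases of these three-dimensional spaces, so some vector of \<open>A\<close> lies in the
  kernel of the form.

  Semi-Kaehler: a 5-form on a 6-dimensional space vanishes as soon as it does on the six
  5-element subsets of a basis.

  Scalar curvature: both eigenspaces are null for a metric built from a compatible form, \<open>A\<close> is an
  abelian ideal and \<open>B\<close> a subalgebra. Koszul's formula gives \<open>D\<^sub>A A = 0\<close>, \<open>D\<^sub>A B \<subseteq> A\<close>,
  \<open>D\<^sub>B A \<subseteq> A\<close> and \<open>D\<^sub>B B \<subseteq> B\<close>. Hence for \<open>Y\<close> and \<open>Z\<close> in different eigenspaces
  \<open>X \<mapsto> R(X, Y) Z\<close> kills \<open>A\<close> and maps \<open>B\<close> to \<open>A\<close>, so that \<open>Ric(Y, Z) = 0\<close>, while the inverse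
  metric has only mixed components.
\<close>

section \<open>Alternating forms\<close>

lemma is_form_linear:
  assumes "is_form k \<alpha>" "length xs = k" "i < k"
  shows "linear (\<lambda>x. \<alpha> (xs[i := x]))"
  using assms by (simp add: is_form_def)

text \<open>Polarisation: with all other slots frozen, the form is a bilinear map \<open>G\<close>
  of slots \<open>i\<close> and \<open>j\<close> that vanishes on the diagonal, and
  \<open>G (u + v) (u + v) = 0\<close> expands to \<open>G u v + G v u = 0\<close>.\<close>

lemma is_form_swap:
  assumes \<alpha>: "is_form k \<alpha>" and len: "length xs = k" and ij: "i < k" "j < k" "i \<noteq> j"
  shows "\<alpha> (xs[i := xs ! j, j := xs ! i]) = - \<alpha> xs"
proof -
  define G where "G u v = \<alpha> (xs[i := u, j := v])" for u v
  have lin1: "linear (\<lambda>u. G u v)" for v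
    using is_form_linear[OF \<alpha>, of "xs[j := v]" i] len ij by (simp add: G_def list_update_swap)
  have lin2: "linear (G u)" for u
    using is_form_linear[OF \<alpha>, of "xs[i := u]" j] len ij by (simp add: G_def[abs_def])
  have diag: "G u u = 0" for u
  proof -
    have "\<not> distinct (xs[i := u, j := u])"
      using nth_eq_iff_index_eq[of "xs[i := u, j := u]" i j] len ij by auto
    then show ?thesis
      using \<alpha> len by (simp add: is_form_def G_def)
  qed
  let ?u = "xs ! i" and ?v = "xs ! j"
  have "0 = G (?u + ?v) (?u + ?v)"
    by (simp add: diag)
  also have "\<dots> = G ?u ?v + G ?v ?u"
    by (simp only: linear_add[OF lin1] linear_add[OF lin2]) (simp add: diag)
  finally show ?thesis
    by (simp add: G_def)
qed

text \<open>A permutation is a product of transpositions, each of which only changes the sign.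
  Tracking vanishing instead of the value avoids all sign bookkeeping.\<close>

lemma is_form_permute_eq_0:
  assumes \<alpha>: "is_form k \<alpha>" and p: "p permutes {..<k}" and "length xs = k" "\<alpha> xs = 0"
  shows "\<alpha> (permute_list p xs) = 0"
  using p finite_lessThan assms(3,4)
proof (induction arbitrary: xs rule: permutes_induct)
  case id
  then show ?case by simp
next
  case (swap a b p)
  have ab: "Transposition.transpose a b permutes {..<k}"
    using swap by (intro permutes_swap_id)
  have t: "permute_list (Transposition.transpose a b) xs = xs[a := xs ! b, b := xs ! a]"
    using swap by (intro nth_equalityI) (auto simp: permute_list_def Transposition.transpose_def nth_list_update)
  have "\<alpha> (permute_list (Transposition.transpose a b) xs) = 0"
    using is_form_swap[OF \<alpha>, of xs a b] swap by (simp add: t)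
  then have "\<alpha> (permute_list p (permute_list (Transposition.transpose a b) xs)) = 0"
    using swap by simp
  then show ?case
    using permute_list_compose[of p xs "Transposition.transpose a b"] swap by metis
qed

lemma is_form_mset_eq_0:
  assumes \<alpha>: "is_form k \<alpha>" and "mset xs = mset ys" and "length ys = k" "\<alpha> ys = 0"
  shows "\<alpha> xs = 0"
proof -
  obtain p where "p permutes {..<length ys}" "permute_list p ys = xs"
    using mset_eq_permutation assms(2) by metis
  then show ?thesis
    using is_form_permute_eq_0[OF \<alpha>] assms(3,4) by blast
qed

lemma linear_eq_0_axis:
  fixes f :: "real^'n \<Rightarrow> 'b::real_vector"
  assumes "linear f" "\<And>i. f (axis i 1) = 0"
  shows "f x = 0"
proof -
  have "f x = f (\<Sum>i\<in>UNIV. x $ i *\<^sub>R axis i 1)"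
    using basis_expansion[of x] by (simp add: scalar_mult_eq_scaleR)
  then show ?thesis
    by (simp add: linear_sum[OF assms(1)] linear_cmul[OF assms(1)] assms(2))
qed

lemma is_form_eq_0_axis:
  fixes \<alpha> :: "(real^'n) form"
  assumes \<alpha>: "is_form k \<alpha>"
    and ax: "\<And>js. length js = k \<Longrightarrow> \<alpha> (map (\<lambda>j. axis j 1) js) = 0"
    and "length xs = k"
  shows "\<alpha> xs = 0"
proof -
  \<comment> \<open>Here \<open>n\<close> bounds the leading slots that may still hold arbitrary
    vectors. Linearity in slot \<open>n\<close> replaces its entry by basis vectors; at
    \<open>n = k\<close> the list is unrestricted.\<close>
  have "\<alpha> xs = 0" if "length xs = k" "\<And>i. n \<le> i \<Longrightarrow> i < k \<Longrightarrow> xs ! i \<in> range (\<lambda>j. axis j 1)" for n xs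
    using that
  proof (induction n arbitrary: xs)
    case 0
    then have "\<forall>i<k. \<exists>j. xs ! i = axis j 1"
      by auto
    then obtain j where "\<And>i. i < k \<Longrightarrow> xs ! i = axis (j i) 1"
      by metis
    then have "xs = map (\<lambda>j. axis j 1) (map j [0..<k])"
      using 0 by (intro nth_equalityI) auto
    then show ?case
      using ax[of "map j [0..<k]"] by simp
  next
    case (Suc n)
    show ?case
    proof (cases "n < k")
      case True
      have "\<alpha> (xs[n := axis i 1]) = 0" for i
      proof (rule Suc.IH)
        show "xs[n := axis i 1] ! m \<in> range (\<lambda>j. axis j 1)" if "n \<le> m" "m < k" for m
          using that Suc.prems True by (cases "m = n") auto
      qed (use Suc.prems in simp)
      from linear_eq_0_axis[OF is_form_linear[OF \<alpha> Suc.prems(1) True] this, of "xs ! n"]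
      show ?thesis by simp
    next
      case False
      then show ?thesis using Suc by auto
    qed
  qed
  from this[of xs k] show ?thesis
    using assms(3) by simp
qed

text \<open>In degree one less than the dimension, a list of basis vectors either repeats an entry
  or enumerates all indices except one. As the order is irrelevant for vanishing, one list for each
  omitted index \<open>m\<close> suffices.\<close>

lemma is_form_eq_0_hyperplanes:
  fixes \<alpha> :: "(real^'n) form"
  assumes \<alpha>: "is_form k \<alpha>" and k: "Suc k = CARD('n)"
    and ex: "\<And>m. \<exists>js. distinct js \<and> set js = - {m} \<and> \<alpha> (map (\<lambda>j. axis j 1) js) = 0"
    and "length xs = k"
  shows "\<alpha> xs = 0"
proof (rule is_form_eq_0_axis[OF \<alpha> _ assms(4)])
  fix js :: "'n list"
  assume len: "length js = k"
  show "\<alpha> (map (\<lambda>j. axis j 1) js) = 0"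
  proof (cases "distinct js")
    case True
    then have "card (set js) = k"
      using len by (simp add: distinct_card)
    then have "card (- set js) = 1"
      using k by (simp add: card_Diff_subset Compl_eq_Diff_UNIV)
    then obtain m where m: "- set js = {m}"
      using card_1_singletonE by blast
    then have "set js = - {m}"
      by auto
    moreover obtain ks where ks: "distinct ks" "set ks = - {m}" "\<alpha> (map (\<lambda>j. axis j 1) ks) = 0"
      using ex by blast
    ultimately have "mset js = mset ks"
      using True by (simp flip: set_eq_iff_mset_eq_distinct)
    then have "mset (map (\<lambda>j. axis j (1::real)) js) = mset (map (\<lambda>j. axis j 1) ks)" "length ks = k"
      using len by (simp_all flip: size_mset)
    then show ?thesis
      using is_form_mset_eq_0[OF \<alpha>] ks(3) by fastforce
  next
    case False
    then have "\<not> distinct (map (\<lambda>j. axis j (1::real)) js)"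
      by (simp add: distinct_map)
    then show ?thesis
      using \<alpha> len by (simp add: is_form_def)
  qed
qed

section \<open>The square of a 2-form and its exterior derivative\<close>

lemma is_form_2_skew:
  assumes "is_form 2 \<omega>"
  shows "\<omega> [X, Y] = - \<omega> [Y, X]"
  using is_form_swap[OF assms, of "[Y, X]" 0 1] by simp

text \<open>The 24 permutations fall into groups of eight, one for each splitting of the four
  arguments into two pairs; dividing by \<open>2! * 2!\<close> leaves the factor 2.\<close>

lemma wedge_2_2:
  assumes "is_form 2 \<omega>"
  shows "wedge 2 2 \<omega> \<omega> [X, Y, Z, W] =
    2 * (\<omega> [X, Y] * \<omega> [Z, W] - \<omega> [X, Z] * \<omega> [Y, W] + \<omega> [X, W] * \<omega> [Y, Z])"
proof -
  have S: "{..<2+2} = {0::nat, 1, 2, 3}" by auto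
  have f0: "finite {1::nat, 2, 3}" "0 \<notin> {1::nat, 2, 3}"
    and f1: "finite {2::nat, 3}" "1 \<notin> {2::nat, 3}"
    and f2: "finite {3::nat}" "2 \<notin> {3::nat}"
    by auto
  have upt: "[2..<2+2] = [2, 3::nat]" "[0..<2] = [0, 1::nat]" by (simp_all add: upt_rec)
  note skew = is_form_2_skew[OF assms]
  show ?thesis
    unfolding wedge_def S sum_over_permutations_insert[OF f0] sum_over_permutations_insert[OF f1]
      sum_over_permutations_insert[OF f2] permutes_sing
    by (simp add: upt sign_swap_id sign_compose permutation_swap_id permutation_compose Transposition.transpose_def
        skew[of Y X] skew[of Z X] skew[of Z Y] skew[of W X] skew[of W Y] skew[of W Z])
qed

lemma ext_deriv_4:
  "ext_deriv br \<alpha> [a, b, c, d, f] =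
     - \<alpha> [br a b, c, d, f] + \<alpha> [br a c, b, d, f] - \<alpha> [br b c, a, d, f] - \<alpha> [br a d, b, c, f]
     + \<alpha> [br b d, a, c, f] - \<alpha> [br c d, a, b, f] + \<alpha> [br a f, b, c, d] - \<alpha> [br b f, a, c, d]
     + \<alpha> [br c f, a, b, d] - \<alpha> [br d f, a, b, c]"
  by (simp add: ext_deriv_def numeral_eq_Suc lessThan_Suc nths_Cons)

text \<open>This makes the vanishing criterion on basis lists available for the derivative of the
  square of a 2-form.\<close>

lemma is_form_5_ext_deriv:
  assumes br: "lie_bracket br" and w: "is_form 2 \<omega>"
  shows "is_form 5 (ext_deriv br (wedge 2 2 \<omega> \<omega>))"
proof -
  have bb: "bilinear br" and alt: "br X X = 0" for X
    using br by (auto simp: lie_bracket_def)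
  have bw: "bilinear (\<lambda>X Y. \<omega> [X, Y])" and walt: "\<omega> [X, X] = 0" for X
    using w by (auto simp: is_form_2)
  have skew: "br X Y = - br Y X" for X Y
  proof -
    have "br (X + Y) (X + Y) = (br X X + br X Y) + (br Y X + br Y Y)"
      by (simp only: bilinear_ladd[OF bb] bilinear_radd[OF bb] ac_simps)
    then have "br X Y + br Y X = 0"
      by (simp only: alt add_0_left add_0_right)
    then show ?thesis
      by (simp only: eq_neg_iff_add_eq_0)
  qed
  have bskew: "\<omega> [br X Y, Z] = - \<omega> [br Y X, Z]" for X Y Z
    using bilinear_lneg[OF bw, of "br Y X" Z] by (simp add: skew[of X Y])
  note wskew = is_form_2_skew[OF w]
  note bil = bilinear_ladd[OF bw] bilinear_radd[OF bw] bilinear_lmul[OF bw] bilinear_rmul[OF bw]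
    bilinear_ladd[OF bb] bilinear_radd[OF bb] bilinear_lmul[OF bb] bilinear_rmul[OF bb]
  have wbalt: "\<omega> [br X X, Z] = 0" for X Z
    using bilinear_lzero[OF bw] by (simp add: alt)
  show ?thesis
    unfolding is_form_def
  proof (intro conjI allI impI)
    fix xs :: "'a list" and i :: nat
    assume "length xs = 5" "i < 5"
    then obtain a b c d f where xs: "xs = [a, b, c, d, f]"
      by (auto simp: numeral_eq_Suc length_Suc_conv)
    from \<open>i < 5\<close> consider "i = 0" | "i = Suc 0" | "i = Suc (Suc 0)" | "i = Suc (Suc (Suc 0))"
      | "i = Suc (Suc (Suc (Suc 0)))" by linarith
    then show "linear (\<lambda>x. ext_deriv br (wedge 2 2 \<omega> \<omega>) (xs[i := x]))"
      by cases (simp_all add: xs ext_deriv_4 wedge_2_2[OF w] linear_iff bil algebra_simps)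
  next
    fix xs :: "'a list"
    assume "length xs = 5" and nd: "\<not> distinct xs"
    then obtain a b c d f where xs: "xs = [a, b, c, d, f]"
      by (auto simp: numeral_eq_Suc length_Suc_conv)
    from nd consider "a = b" | "a = c" | "a = d" | "a = f" | "b = c" | "b = d" | "b = f"
      | "c = d" | "c = f" | "d = f"
      unfolding xs by auto
    \<comment> \<open>The instances of skew-symmetry put each pair of arguments into alphabetical
      order, so that the terms left after identifying two arguments cancel.\<close>
    then show "ext_deriv br (wedge 2 2 \<omega> \<omega>) xs = 0"
      unfolding xs ext_deriv_4 wedge_2_2[OF w]
      by cases (simp_all add: wbalt walt
          bskew[of b a] bskew[of c a] bskew[of d a] bskew[of f a] bskew[of c b] bskew[of d b]
          bskew[of f b] bskew[of d c] bskew[of f c] bskew[of f d]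
          wskew[of b a] wskew[of c a] wskew[of d a] wskew[of f a] wskew[of c b] wskew[of d b]
          wskew[of f b] wskew[of d c] wskew[of f c] wskew[of f d] algebra_simps)
  qed
qed

section \<open>Metrics with two complementary null subalgebras\<close>

text \<open>Torsion-freeness turns the three brackets into six terms \<open>g (D A B) C\<close>.
  Skewness of this expression in \<open>B\<close> and \<open>C\<close> cancels four of them and
  makes the other two equal.\<close>

lemma koszul:
  assumes g: "pseudo_metric g" and D: "levi_civita br g D"
  shows "2 * g (D X Y) Z = g (br X Y) Z - g (br Y Z) X + g (br Z X) Y"
proof -
  have bg: "bilinear g" and sym: "g A B = g B A" for A B
    using g by (auto simp: pseudo_metric_def)
  have t: "br A B = D A B - D B A" for A B
    using D unfolding levi_civita_def by metis
  have m: "g (D A B) C = - g (D A C) B" for A B C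
    using D sym[of B "D A C"] unfolding levi_civita_def by (metis eq_neg_iff_add_eq_0)
  show ?thesis
    using m[of X Y Z] m[of Y Z X] m[of Z X Y]
    by (simp only: t bilinear_lsub[OF bg])
qed

text \<open>A vector in the kernel of the Gram matrix is orthogonal to every basis vector, hence
  zero by nondegeneracy.\<close>

lemma pseudo_metric_matrix_inv:
  assumes g: "pseudo_metric g"
  shows "gram g ** matrix_inv (gram g) = mat 1" "matrix_inv (gram g) ** gram g = mat 1"
proof -
  have bg: "bilinear g" and nd: "\<And>v. (\<And>z. g v z = 0) \<Longrightarrow> v = 0" and sym: "g X Y = g Y X" for X Y
    using g by (auto simp: pseudo_metric_def nondegenerate_def)
  have lin: "linear (\<lambda>x. g x y)" "linear (g x)" for x y
    using bg by (auto simp: bilinear_def)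
  have "v = 0" if "gram g *v v = 0" for v
  proof (rule nd)
    fix z
    have ax: "g (axis i 1) v = 0" for i
    proof -
      have "g (axis i 1) v = g (axis i 1) (\<Sum>j\<in>UNIV. v $ j *\<^sub>R axis j 1)"
        using basis_expansion[of v] by (simp add: scalar_mult_eq_scaleR)
      also have "\<dots> = (gram g *v v) $ i"
        by (simp add: linear_sum[OF lin(2)] linear_cmul[OF lin(2)] gram_def matrix_vector_mult_def mult.commute)
      finally show ?thesis using that by simp
    qed
    have "g v z = g (\<Sum>j\<in>UNIV. z $ j *\<^sub>R axis j 1) v"
      using basis_expansion[of z] by (simp add: scalar_mult_eq_scaleR sym)
    then show "g v z = 0"
      by (simp add: linear_sum[OF lin(1)] linear_cmul[OF lin(1)] ax)
  qed
  then have "invertible (gram g)"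
    by (simp add: invertible_left_inverse matrix_left_invertible_ker)
  then show "gram g ** matrix_inv (gram g) = mat 1" "matrix_inv (gram g) ** gram g = mat 1"
    unfolding invertible_def matrix_inv_def by (metis (mono_tags, lifting) someI_ex)+
qed

text \<open>Let \<open>s\<close> be the diagonal sign matrix that is 1 on \<open>S\<close> and -1
  off \<open>S\<close>. The hypothesis says \<open>s M s = - M\<close>, so
  \<open>Q = - s N s\<close> is also an inverse of \<open>M\<close>. Uniqueness gives
  \<open>N = - s N s\<close>, which kills the two diagonal blocks.\<close>

lemma matrix_inv_offdiagonal:
  fixes M N :: "real^'n^'n"
  assumes MN: "M ** N = mat 1" "N ** M = mat 1"
    and M: "\<And>i j. (i \<in> S \<longleftrightarrow> j \<in> S) \<Longrightarrow> M $ i $ j = 0"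
    and ij: "i \<in> S \<longleftrightarrow> j \<in> S"
  shows "N $ i $ j = 0"
proof -
  define s where "s i = (if i \<in> S then 1 else - 1 :: real)" for i
  define Q :: "real^'n^'n" where "Q = (\<chi> i j. - (s i * s j * N $ i $ j))"
  have sM: "s i * s j * M $ i $ j = - M $ i $ j" for i j
    using M[of i j] by (auto simp: s_def)
  have ss: "s i * s i = 1" for i
    by (simp add: s_def)
  have "(M ** Q) $ i $ j = (mat 1 :: real^'n^'n) $ i $ j" for i j
  proof -
    have "(M ** Q) $ i $ j = (\<Sum>k\<in>UNIV. s i * s j * (M $ i $ k * N $ k $ j))"
      unfolding matrix_matrix_mult_def Q_def
    proof (simp, rule sum.cong[OF refl])
      fix k
      have "s i * s j * (M $ i $ k * N $ k $ j) = s i * s j * (s k * s k * (M $ i $ k * N $ k $ j))"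
        by (simp add: ss)
      also have "\<dots> = (s i * s k * M $ i $ k) * (s k * s j * N $ k $ j)"
        by (simp add: mult_ac)
      also have "\<dots> = - (M $ i $ k * (s k * s j * N $ k $ j))"
        by (simp only: sM mult_minus_left)
      finally show "- (M $ i $ k * (s k * s j * N $ k $ j)) = s i * s j * (M $ i $ k * N $ k $ j)"
        by simp
    qed
    also have "\<dots> = s i * s j * (M ** N) $ i $ j"
      by (simp add: matrix_matrix_mult_def sum_distrib_left)
    also have "\<dots> = (mat 1 :: real^'n^'n) $ i $ j"
      by (simp add: MN mat_def ss)
    finally show ?thesis .
  qed
  then have "M ** Q = mat 1"
    by (simp add: vec_eq_iff)
  then have "Q = N"
    using MN(2) by (metis matrix_mul_assoc matrix_mul_lid matrix_mul_rid)
  then have "N $ i $ j = - (s i * s j * N $ i $ j)"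
    by (simp add: Q_def vec_eq_iff)
  moreover have "s i * s j = 1"
    using ij by (simp add: s_def)
  ultimately show ?thesis by simp
qed

text \<open>The two null subspaces are spanned by basis vectors, which lets the trace and the
  inverse metric be read off blockwise.\<close>

lemma scalar_curvature_split_eq_0:
  fixes g :: "real^'n \<Rightarrow> real^'n \<Rightarrow> real" and S :: "'n set"
  defines "A \<equiv> {X :: real^'n. \<forall>i. i \<notin> S \<longrightarrow> X $ i = 0}"
    and "B \<equiv> {X :: real^'n. \<forall>i\<in>S. X $ i = 0}"
  assumes br: "lie_bracket br" and g: "pseudo_metric g"
    and gAA: "\<And>X Y. X \<in> A \<Longrightarrow> Y \<in> A \<Longrightarrow> g X Y = 0"
    and gBB: "\<And>X Y. X \<in> B \<Longrightarrow> Y \<in> B \<Longrightarrow> g X Y = 0"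
    and AA: "\<And>X Y. X \<in> A \<Longrightarrow> Y \<in> A \<Longrightarrow> br X Y = 0"
    and BA: "\<And>X Y. X \<in> B \<Longrightarrow> Y \<in> A \<Longrightarrow> br X Y \<in> A"
    and BB: "\<And>X Y. X \<in> B \<Longrightarrow> Y \<in> B \<Longrightarrow> br X Y \<in> B"
  shows "scalar_curvature br g = 0"
proof -
  define D where "D = (THE D. levi_civita br g D)"
  have D: "levi_civita br g D"
    unfolding D_def by (rule theI'[OF levi_civita_ex1[OF br g]])
  note K = koszul[OF g D]
  have bg: "bilinear g" and sym: "g X Y = g Y X" and nd: "\<And>v. (\<And>z. g v z = 0) \<Longrightarrow> v = 0" for X Y
    using g by (auto simp: pseudo_metric_def nondegenerate_def)
  have bD: "bilinear D" and tor: "D X Y - D Y X = br X Y" for X Y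
    using D by (auto simp: levi_civita_def)
  have skew: "br X Y = - br Y X" for X Y
    using tor by (metis minus_diff_eq)
  have A_closed: "X \<in> A \<Longrightarrow> Y \<in> A \<Longrightarrow> X + Y \<in> A" "X \<in> A \<Longrightarrow> Y \<in> A \<Longrightarrow> X - Y \<in> A"
    "X \<in> A \<Longrightarrow> - X \<in> A" for X Y
    by (auto simp: A_def)
  have AB: "br X Y \<in> A" if "X \<in> A" "Y \<in> B" for X Y
    using BA[OF that(2,1)] A_closed by (simp add: skew[of X Y])
  have g0: "g 0 X = 0" "g X 0 = 0" for X
    by (simp_all add: bilinear_lzero[OF bg] bilinear_rzero[OF bg])
  define pA where "pA X = (\<chi> i. if i \<in> S then X $ i else 0)" for X :: "real^'n"
  define pB where "pB X = (\<chi> i. if i \<in> S then 0 else X $ i)" for X :: "real^'n"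
  have p: "pA X \<in> A" "pB X \<in> B" "X = pA X + pB X" for X
    by (auto simp: pA_def pB_def A_def B_def vec_eq_iff)
  have g_split: "g X Z = g (pA X) Z + g (pB X) Z" for X Z
    by (metis bilinear_ladd[OF bg] p(3))
  have 0: "X = 0" if "\<And>Z. Z \<in> A \<Longrightarrow> g X Z = 0" "\<And>Z. Z \<in> B \<Longrightarrow> g X Z = 0" for X
  proof (rule nd)
    show "g X Z = 0" for Z
      using that p(1,2) by (subst p(3)[of Z]) (simp add: bilinear_radd[OF bg])
  qed
  \<comment> \<open>\<open>A\<close> is its own orthogonal complement: the \<open>B\<close>-part of
    such a vector is orthogonal to \<open>A\<close> by assumption and to \<open>B\<close> because
    \<open>B\<close> is null.\<close>
  have perpA: "X \<in> A" if "\<And>Z. Z \<in> A \<Longrightarrow> g X Z = 0" for X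
  proof -
    have "g (pB X) Z = 0" if "Z \<in> A" for Z
      using \<open>\<And>Z. Z \<in> A \<Longrightarrow> g X Z = 0\<close>[OF that] gAA[OF p(1) that]
      by (simp add: g_split[of X Z])
    then have "pB X = 0"
      using gBB[OF p(2)] by (intro 0) blast+
    then show ?thesis
      using p by (metis add.right_neutral)
  qed
  \<comment> \<open>Against \<open>A\<close> all brackets in Koszul's formula vanish; against
    \<open>B\<close> they lie in \<open>A\<close> and are paired with vectors of the null space
    \<open>A\<close>.\<close>
  have DAA: "D x y = 0" if "x \<in> A" "y \<in> A" for x y
  proof (rule 0)
    show "g (D x y) z = 0" if "z \<in> A" for z
      using K[of x y z] \<open>x \<in> A\<close> \<open>y \<in> A\<close> that by (simp add: AA g0)
    show "g (D x y) z = 0" if "z \<in> B" for z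
      using K[of x y z] \<open>x \<in> A\<close> \<open>y \<in> A\<close> that by (simp add: AA AB BA gAA g0)
  qed
  have DAB: "D x b \<in> A" if "x \<in> A" "b \<in> B" for x b
  proof (rule perpA)
    show "g (D x b) z = 0" if "z \<in> A" for z
      using K[of x b z] \<open>x \<in> A\<close> \<open>b \<in> B\<close> that by (simp add: AA AB BA gAA g0)
  qed
  \<comment> \<open>By torsion-freeness this differs from \<open>D x b\<close> by a bracket in the
    ideal \<open>A\<close>.\<close>
  have DBA: "D b x \<in> A" if "x \<in> A" "b \<in> B" for x b
  proof -
    have "D b x = br b x + D x b" using tor[of b x] by (simp add: algebra_simps)
    then show ?thesis using that by (simp add: A_closed BA DAB)
  qed
  have DBB: "g (D b c) z = 0" if "b \<in> B" "c \<in> B" "z \<in> B" for b c z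
    using K[of b c z] that by (simp add: BB gBB)
  have perpB: "X \<in> B" if "\<And>Z. Z \<in> B \<Longrightarrow> g X Z = 0" for X
  proof -
    have "g (pA X) Z = 0" if "Z \<in> B" for Z
      using \<open>\<And>Z. Z \<in> B \<Longrightarrow> g X Z = 0\<close>[OF that] gBB[OF p(2) that]
      by (simp add: g_split[of X Z])
    then have "pA X = 0"
      using gAA[OF p(1)] by (intro 0) blast+
    then show ?thesis
      using p by (metis add_0)
  qed
  have DB: "D b c \<in> B" if "b \<in> B" "c \<in> B" for b c
    using perpB DBB that by blast
  note types = DAA DAB DBA DB A_closed AA AB BA BB
  have zero: "0 \<in> A" and D0: "D 0 X = 0" "D X 0 = 0" for X
    by (simp_all add: A_def bilinear_lzero[OF bD] bilinear_rzero[OF bD])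
  \<comment> \<open>Such a map is strictly block triangular for the splitting into \<open>A\<close>
    and \<open>B\<close>, so its diagonal entries vanish.\<close>
  have trace0: "trace (matrix F) = 0"
    if FA: "\<And>x. x \<in> A \<Longrightarrow> F x = 0" and FB: "\<And>b. b \<in> B \<Longrightarrow> F b \<in> A" for F :: "real^'n \<Rightarrow> real^'n"
  proof -
    have "F (axis i 1) $ i = 0" for i
    proof (cases "i \<in> S")
      case True
      then have "axis i 1 \<in> A" by (auto simp: A_def axis_def)
      then show ?thesis using FA by simp
    next
      case False
      then have "axis i 1 \<in> B" by (auto simp: B_def axis_def)
      then show ?thesis using FB False by (auto simp: A_def)
    qed
    then show ?thesis by (simp add: trace_def matrix_def)
  qed
  have ric1: "ricci br D y c = 0" if "y \<in> A" "c \<in> B" for y c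
    unfolding ricci_def curvature_def using that by (intro trace0) (simp_all add: types D0 zero)
  have ric2: "ricci br D c y = 0" if "y \<in> A" "c \<in> B" for y c
    unfolding ricci_def curvature_def using that by (intro trace0) (simp_all add: types D0 zero)
  have ax: "axis i 1 \<in> A \<longleftrightarrow> i \<in> S" "axis i 1 \<in> B \<longleftrightarrow> i \<notin> S" for i :: 'n
    by (auto simp: A_def B_def axis_def)
  \<comment> \<open>For indices of the same block the inverse metric vanishes, for indices of
    different blocks the Ricci tensor does.\<close>
  have "matrix_inv (gram g) $ i $ j * ricci br D (axis i 1) (axis j 1) = 0" for i j
  proof (cases "i \<in> S \<longleftrightarrow> j \<in> S")
    case True
    have "matrix_inv (gram g) $ i $ j = 0"
      by (rule matrix_inv_offdiagonal[OF pseudo_metric_matrix_inv[OF g] _ True])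
         (auto simp: gram_def ax intro: gAA gBB)
    then show ?thesis by simp
  next
    case False
    then show ?thesis
      using ric1[of "axis i 1" "axis j 1"] ric2[of "axis j 1" "axis i 1"] by (auto simp: ax)
  qed
  then show ?thesis
    unfolding scalar_curvature_def Let_def D_def[symmetric] by (intro sum.neutral ballI)
qed

text \<open>Symmetry is compatibility applied to \<open>P X\<close> and \<open>Y\<close>, combined
  with \<open>P (P X) = X\<close> and skewness of the form. Nondegeneracy is inherited since
  \<open>P\<close> is onto.\<close>

lemma pseudo_metric_of:
  assumes P: "almost_paracomplex P" and w: "is_form 2 \<omega>" "nondeg_form \<omega>" "compatible \<omega> P"
  shows "pseudo_metric (metric_of \<omega> P)"
proof -
  have lP: "linear P" and PP: "P (P X) = X" for X
    using P by (auto simp: almost_paracomplex_def)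
  have bw: "bilinear (\<lambda>X Y. \<omega> [X, Y])"
    using w(1) by (auto simp: is_form_2)
  note skew = is_form_2_skew[OF w(1)]
  have "bilinear (metric_of \<omega> P)"
    using bw linear_compose[OF lP, of "\<lambda>Y. \<omega> [_, Y]"]
    by (auto simp: bilinear_def metric_of_def o_def)
  moreover have "metric_of \<omega> P X Y = metric_of \<omega> P Y X" for X Y
    using w(3) skew[of "P X" Y] PP[of X] unfolding compatible_def metric_of_def
    by (metis minus_minus)
  moreover have "nondegenerate (metric_of \<omega> P)"
    using w(2) PP unfolding nondegenerate_def nondeg_form_def metric_of_def by metis
  ultimately show ?thesis by (simp add: pseudo_metric_def)
qed

section \<open>The Lie algebra \<open>\<real>\<^sup>3 \<ltimes> sl(2, \<real>)\<close>\<close>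

lemma ex_list_Compl_6:
  assumes "Q [2, 3, 4, 5, 6]" "Q [1, 3, 4, 5, 6]" "Q [1, 2, 4, 5, 6]" "Q [1, 2, 3, 5, 6]"
    "Q [1, 2, 3, 4, 6]" "Q [1, 2, 3, 4, 5]"
  shows "\<exists>js. distinct js \<and> set js = - {m :: 6} \<and> Q js"
proof -
  have Compl: "- {m} = {1, 2, 3, 4, 5, 6} - {m}"
    by (simp add: Compl_eq_Diff_UNIV UNIV_6)
  consider "m = 1" | "m = 2" | "m = 3" | "m = 4" | "m = 5" | "m = 6"
    using exhaust_6[of m] by blast
  then show ?thesis
  proof cases
    case 1 then show ?thesis unfolding Compl using assms(1) by (intro exI[of _ "[2, 3, 4, 5, 6]"]) auto
  next
    case 2 then show ?thesis unfolding Compl using assms(2) by (intro exI[of _ "[1, 3, 4, 5, 6]"]) auto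
  next
    case 3 then show ?thesis unfolding Compl using assms(3) by (intro exI[of _ "[1, 2, 4, 5, 6]"]) auto
  next
    case 4 then show ?thesis unfolding Compl using assms(4) by (intro exI[of _ "[1, 2, 3, 5, 6]"]) auto
  next
    case 5 then show ?thesis unfolding Compl using assms(5) by (intro exI[of _ "[1, 2, 3, 4, 6]"]) auto
  next
    case 6 then show ?thesis unfolding Compl using assms(6) by (intro exI[of _ "[1, 2, 3, 4, 5]"]) auto
  qed
qed

text \<open>The six lists omit one basis vector each, so that closedness becomes a finite
  computation with the structure constants.\<close>

lemma closed_form_4_g3:
  assumes w: "is_form 2 \<omega>"
    and basis: "\<And>js. js \<in> {[2, 3, 4, 5, 6], [1, 3, 4, 5, 6], [1, 2, 4, 5, 6], [1, 2, 3, 5, 6],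
      [1, 2, 3, 4, 6], [1, 2, 3, 4, 5]} \<Longrightarrow> ext_deriv g3 (wedge 2 2 \<omega> \<omega>) (map e js) = 0"
  shows "closed_form 4 g3 (wedge 2 2 \<omega> \<omega>)"
  unfolding closed_form_def
proof (intro allI impI)
  fix xs :: "(real^6) list"
  assume "length xs = Suc 4"
  moreover have "\<exists>js. distinct js \<and> set js = - {m} \<and> ext_deriv g3 (wedge 2 2 \<omega> \<omega>) (map e js) = 0" for m
    by (intro ex_list_Compl_6 basis) simp_all
  ultimately show "ext_deriv g3 (wedge 2 2 \<omega> \<omega>) xs = 0"
    by (intro is_form_eq_0_hyperplanes[OF is_form_5_ext_deriv[OF lie_bracket_g3 w]]) simp_all
qed

section \<open>The two families of semi-Kaehler forms\<close>

lemma omega1_apply: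
  "omega1 w15 w24 w25 w26 w35 w36 [X, Y] =
     X$1 * (- w25 * Y$4 + w15 * Y$5 - w35 * Y$6) - Y$1 * (- w25 * X$4 + w15 * X$5 - w35 * X$6)
   + X$2 * (w24 * Y$4 + w25 * Y$5 + w26 * Y$6) - Y$2 * (w24 * X$4 + w25 * X$5 + w26 * X$6)
   + X$3 * (w26 * Y$4 + w35 * Y$5 - w36 * Y$6) - Y$3 * (w26 * X$4 + w35 * X$5 - w36 * X$6)"
  unfolding omega1_def wedge_1_1 ed_def by (simp add: algebra_simps)

lemma omega2_apply:
  "omega2 w14 w15 w24 w34 w35 [X, Y] =
     X$1 * (w14 * Y$4 + w15 * Y$5 - w35 * Y$6) - Y$1 * (w14 * X$4 + w15 * X$5 - w35 * X$6)
   + X$2 * (w24 * Y$4 - w14 * Y$5 + w34 * Y$6) - Y$2 * (w24 * X$4 - w14 * X$5 + w34 * X$6)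
   + X$3 * (w34 * Y$4 + w35 * Y$5) - Y$3 * (w34 * X$4 + w35 * X$5)"
  unfolding omega2_def wedge_1_1 ed_def by (simp add: algebra_simps)

lemma is_form_omega1: "is_form 2 (omega1 w15 w24 w25 w26 w35 w36)"
  unfolding is_form_2 bilinear_def linear_iff by (simp add: omega1_apply algebra_simps)

lemma is_form_omega2: "is_form 2 (omega2 w14 w15 w24 w34 w35)"
  unfolding is_form_2 bilinear_def linear_iff by (simp add: omega2_apply algebra_simps)

lemma closed_omega1:
  fixes w15 w24 w25 w26 w35 w36 :: real
  defines "\<omega> \<equiv> omega1 w15 w24 w25 w26 w35 w36"
  shows "closed_form 4 g3 (wedge 2 2 \<omega> \<omega>)"
  unfolding \<omega>_def
  by (rule closed_form_4_g3[OF is_form_omega1])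
    (auto simp add: ext_deriv_4 wedge_2_2[OF is_form_omega1] omega1_apply g3_components axis_def)

lemma closed_omega2:
  fixes w14 w15 w24 w34 w35 :: real
  defines "\<omega> \<equiv> omega2 w14 w15 w24 w34 w35"
  shows "closed_form 4 g3 (wedge 2 2 \<omega> \<omega>)"
  unfolding \<omega>_def
  by (rule closed_form_4_g3[OF is_form_omega2])
    (auto simp add: ext_deriv_4 wedge_2_2[OF is_form_omega2] omega2_apply g3_components axis_def)

section \<open>The paracomplex structure and its metrics\<close>

lemma P0_components:
  "P0 X $ 1 = X $ 1" "P0 X $ 2 = X $ 2" "P0 X $ 3 = X $ 3"
  "P0 X $ 4 = - X $ 4" "P0 X $ 5 = - X $ 5" "P0 X $ 6 = - X $ 6"
  by (simp_all add: P0_def)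

lemma paracomplex_P0: "paracomplex g3 P0"
proof -
  have lin: "linear P0"
    unfolding linear_iff vec_eq_iff forall_6 by (simp add: P0_components)
  \<comment> \<open>Indices are taken modulo 6, so a shift by 3 is an involution exchanging the
    first three coordinates with the last three. It maps one eigenspace of \<open>P0\<close> onto
    the other, which gives equal dimensions.\<close>
  define T :: "real^6 \<Rightarrow> real^6" where "T X = (\<chi> i. X $ (i + 3))" for X
  have six: "(7 :: 6) = 1" "(8 :: 6) = 2" "(9 :: 6) = 3"
  proof -
    have "(6 :: 6) = 0" by simp
    then have "(6 :: 6) + 1 = 1" "(6 :: 6) + 2 = 2" "(6 :: 6) + 3 = 3" by (simp_all only: add_0)
    then show "(7 :: 6) = 1" "(8 :: 6) = 2" "(9 :: 6) = 3" by simp_all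
  qed
  have TC: "T X $ 1 = X $ 4" "T X $ 2 = X $ 5" "T X $ 3 = X $ 6"
    "T X $ 4 = X $ 1" "T X $ 5 = X $ 2" "T X $ 6 = X $ 3" for X
    by (simp_all add: T_def six)
  have T: "linear T" "T (T X) = X" for X
    unfolding linear_iff vec_eq_iff forall_6 by (simp_all add: TC)
  have "T ` {X. P0 X = X} = {X. P0 X = - X}"
  proof
    show "T ` {X. P0 X = X} \<subseteq> {X. P0 X = - X}"
      unfolding vec_eq_iff forall_6 by (auto simp: P0_components TC)
    have "T X \<in> {X. P0 X = X}" if "P0 X = - X" for X
      using that unfolding vec_eq_iff forall_6 by (auto simp: P0_components TC vec_eq_iff forall_6)
    then show "{X. P0 X = - X} \<subseteq> T ` {X. P0 X = X}"
      by (intro subsetI image_eqI[where f = T, OF T(2)[symmetric]]) blast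
  qed
  moreover have "inj T"
    by (metis T(2) injI)
  ultimately have dim: "dim {X. P0 X = X} = dim {X. P0 X = - X}"
    using dim_image_eq[of T "{X. P0 X = X}"] T(1) by (metis inj_on_subset subset_UNIV)
  have PP: "P0 (P0 X) = X" for X
    unfolding vec_eq_iff forall_6 by (simp add: P0_components)
  show ?thesis
    unfolding paracomplex_def almost_paracomplex_def
    using lin dim PP by (simp add: vec_eq_iff forall_6 P0_components g3_components)
qed

text \<open>On either eigenspace of \<open>P0\<close>, compatibility says that the form equals its
  own negative. Both eigenspaces are therefore null for the metric, and the splitting criterion
  applies with \<open>S = {1, 2, 3}\<close>.\<close>

lemma scalar_curvature_g3:
  assumes w: "is_form 2 \<omega>" "nondeg_form \<omega>" "compatible \<omega> P0"
  shows "scalar_curvature g3 (metric_of \<omega> P0) = 0"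
proof -
  let ?A = "{X :: real^6. \<forall>i. i \<notin> {1, 2, 3} \<longrightarrow> X $ i = 0}"
  let ?B = "{X :: real^6. \<forall>i \<in> {1, 2, 3}. X $ i = 0}"
  have bw: "bilinear (\<lambda>X Y. \<omega> [X, Y])"
    using w(1) by (simp add: is_form_2)
  have PA: "P0 X = X" if "X \<in> ?A" for X
    using that unfolding vec_eq_iff forall_6 mem_Collect_eq by (simp add: P0_components)
  have PB: "P0 X = - X" if "X \<in> ?B" for X
    using that unfolding vec_eq_iff forall_6 mem_Collect_eq by (simp add: P0_components)
  have comp: "\<omega> [P0 X, P0 Y] = - \<omega> [X, Y]" for X Y
    using w(3) by (simp add: compatible_def)
  have gA: "metric_of \<omega> P0 X Y = 0" if "X \<in> ?A" "Y \<in> ?A" for X Y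
    using comp[of X Y] PA[OF that(1)] PA[OF that(2)] by (simp add: metric_of_def)
  have gB: "metric_of \<omega> P0 X Y = 0" if "X \<in> ?B" "Y \<in> ?B" for X Y
    using comp[of X Y] PB[OF that(1)] PB[OF that(2)]
    by (simp add: metric_of_def bilinear_lneg[OF bw] bilinear_rneg[OF bw])
  have P: "almost_paracomplex P0"
    using paracomplex_P0 by (simp add: paracomplex_def)
  have AA: "g3 X Y = 0" if "X \<in> ?A" "Y \<in> ?A" for X Y
    using that unfolding vec_eq_iff forall_6 mem_Collect_eq by (simp add: g3_components)
  have BA: "g3 X Y \<in> ?A" if "X \<in> ?B" "Y \<in> ?A" for X Y
    using that unfolding forall_6 mem_Collect_eq by (simp add: g3_components)
  have BB: "g3 X Y \<in> ?B" if "X \<in> ?B" "Y \<in> ?B" for X Y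
    using that unfolding mem_Collect_eq by (simp add: g3_components)
  show ?thesis
    by (rule scalar_curvature_split_eq_0[OF lie_bracket_g3 pseudo_metric_of[OF P w] gA gB AA BA BB])
qed

lemma semi_para_kahler_g3:
  assumes w: "is_form 2 \<omega>" "nondeg_form \<omega>" "compatible \<omega> P0"
    and closed: "closed_form 4 g3 (wedge 2 2 \<omega> \<omega>)"
  shows "semi_kahler g3 \<omega>" "semi_para_kahler g3 \<omega> P0 (metric_of \<omega> P0)"
proof -
  have P: "almost_paracomplex P0"
    using paracomplex_P0 by (simp add: paracomplex_def)
  show "semi_kahler g3 \<omega>"
    using w closed by (simp add: semi_kahler_def)
  then show "semi_para_kahler g3 \<omega> P0 (metric_of \<omega> P0)"
    using P w pseudo_metric_of[OF P w] by (simp add: semi_para_kahler_def metric_of_def[abs_def])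
qed

section \<open>Absence of symplectic forms\<close>

lemma g3_axis: "g3 (e i) (e j) = g3_table i j - g3_table j i"
proof -
  have "g3 (e i) (e j) = (\<Sum>k\<in>UNIV. \<Sum>l\<in>UNIV.
      if l = j then if k = i then g3_table i j - g3_table j i else 0 else 0)"
    unfolding g3_def by (intro sum.cong refl) (auto simp: axis_def)
  then show ?thesis by simp
qed

lemma not_symplectic_g3: "\<not> symplectic g3 \<omega>"
proof
  assume "symplectic g3 \<omega>"
  then have w: "is_form 2 \<omega>" and nd: "\<And>x. (\<And>y. \<omega> [x, y] = 0) \<Longrightarrow> x = 0"
    and "closed_form 2 g3 \<omega>"
    by (auto simp: symplectic_def nondeg_form_def nondegenerate_def)
  then have d: "\<omega> [g3 X Y, Z] - \<omega> [g3 X Z, Y] + \<omega> [g3 Y Z, X] = 0" for X Y Z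
    using ext_deriv_2[of g3 \<omega> X Y Z] by (simp add: closed_form_def)
  have bw: "bilinear (\<lambda>X Y. \<omega> [X, Y])" and alt: "\<omega> [X, X] = 0" for X
    using w by (auto simp: is_form_2)
  note lin = bilinear_lzero[OF bw] bilinear_rzero[OF bw] bilinear_lmul[OF bw] bilinear_rmul[OF bw]
    bilinear_lneg[OF bw] bilinear_rneg[OF bw] bilinear_ladd[OF bw] bilinear_radd[OF bw]
    bilinear_lsub[OF bw] bilinear_rsub[OF bw]
  define c where "c i j = \<omega> [e i, e j]" for i j
  have c_skew: "c i j = - c j i" for i j
    using is_form_2_skew[OF w, of "e i" "e j"] by (simp add: c_def)
  have c_alt: "c i i = 0" for i
    by (simp add: c_def alt)
  have dc: "\<omega> [g3_table i j - g3_table j i, e k] - \<omega> [g3_table i k - g3_table k i, e j]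
    + \<omega> [g3_table j k - g3_table k j, e i] = 0" for i j k
    using d[of "e i" "e j" "e k"] by (simp only: g3_axis)
  note eval = g3_table_def lin c_def[symmetric]
  \<comment> \<open>The first three equations make the span of \<open>e 1\<close>,
    \<open>e 2\<close>, \<open>e 3\<close> isotropic; the other six constrain its pairing with
    \<open>e 4\<close>, \<open>e 5\<close>, \<open>e 6\<close>.\<close>
  have eq1: "c 1 2 = 0"
    using dc[of 1 2 4] by (simp add: eval)
  have eq2: "c 3 1 = 0"
    using dc[of 1 2 6] c_alt[of 2] by (simp add: eval)
  have eq3: "c 3 2 = 0"
    using dc[of 2 3 4] by (simp add: eval)
  have eq4: "c 5 1 = c 1 5"
    using dc[of 1 4 5] by (simp add: eval)
  have eq5: "c 2 4 = 2 * c 1 6 + 2 * c 6 1"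
    using dc[of 1 4 6] by (simp add: eval)
  have eq6: "c 6 3 = c 3 6"
    using dc[of 3 4 6] by (simp add: eval)
  have eq7: "c 1 4 = - c 5 2"
    using dc[of 2 4 5] by (simp add: eval)
  have eq8: "c 3 4 = c 6 2"
    using dc[of 2 4 6] by (simp add: eval)
  have eq9: "2 * c 1 6 = 2 * c 3 5 + c 4 2"
    using dc[of 2 5 6] by (simp add: eval)
  have c: "c 1 2 = 0" "c 1 3 = 0" "c 2 3 = 0" "c 1 5 = 0" "c 2 4 = 0" "c 3 6 = 0"
    "c 1 4 = c 2 5" "c 3 4 = - c 2 6" "c 3 5 = c 1 6"
    using eq1 eq2 eq3 eq4 eq5 eq6 eq7 eq8 eq9 c_skew[of 3 1] c_skew[of 3 2]
      c_skew[of 5 1] c_skew[of 6 1] c_skew[of 6 3] c_skew[of 5 2] c_skew[of 6 2] c_skew[of 4 2]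
    by linarith+
  have ker: "x = 0" if "\<And>j. \<omega> [x, e j] = 0" for x
  proof (rule nd)
    show "\<omega> [x, y] = 0" for y
      using bw that unfolding bilinear_def by (blast intro: linear_eq_0_axis[of "\<lambda>y. \<omega> [x, y]"])
  qed
  \<comment> \<open>By the relations \<open>c\<close>, the pairing of \<open>e 1, e 2, - e 3\<close>
    with \<open>e 5, - e 4, e 6\<close> is a skew 3 by 3 matrix with entries \<open>c 2 5\<close>,
    \<open>c 1 6\<close>, \<open>c 2 6\<close> up to sign. This is the usual kernel vector of such a
    matrix.\<close>
  define x where "x = c 2 6 *\<^sub>R e 1 - c 1 6 *\<^sub>R e 2 + c 2 5 *\<^sub>R e 3"
  have "\<forall>j. \<omega> [x, e j] = 0"
    unfolding x_def forall_6 using c_skew[of 2 1] c_skew[of 3 1] c_skew[of 3 2]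
    by (simp add: lin c_def[symmetric] c c_alt)
  then have "x = 0"
    by (intro ker) blast
  \<comment> \<open>If the kernel vector is zero, its coefficients vanish and with them the whole
    pairing; then \<open>e 1\<close> itself lies in the kernel.\<close>
  then have "c 2 5 = 0" "c 1 6 = 0"
    by (auto simp: x_def vec_eq_iff forall_6 axis_def)
  then have "\<forall>j. \<omega> [e 1, e j] = 0"
    unfolding forall_6 by (simp add: c_def[symmetric] c c_alt)
  then have "e 1 = 0"
    by (intro ker) blast
  then show False
    by simp
qed

section \<open>Compatibility and nondegenerate members of the families\<close>

lemma compatible_omega1: "compatible (omega1 w15 w24 w25 w26 w35 w36) P0"
  by (simp add: compatible_def omega1_apply P0_components algebra_simps)

lemma compatible_omega2: "compatible (omega2 w14 w15 w24 w34 w35) P0"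
  by (simp add: compatible_def omega2_apply P0_components algebra_simps)

text \<open>Both natural forms are members of the first family and inherit its properties; they also
  show that this family has nondegenerate members.\<close>

lemma Omega01_eq: "Omega01 = omega1 0 0 1 0 0 (- 1)"
proof -
  have "(ed 1 \<and>\<^sub>1 (\<lambda>ys. - ed 4 ys)) xs = - (ed 1 \<and>\<^sub>1 ed 4) xs" for xs
    by (simp add: wedge_def sum_negf)
  then show ?thesis
    by (simp add: fun_eq_iff Omega01_def omega1_def)
qed

lemma Omega02_eq: "Omega02 = omega1 0 0 (- 1) 0 0 (- 1)"
proof -
  have "(ed 2 \<and>\<^sub>1 (\<lambda>ys. - ed 5 ys)) xs = - (ed 2 \<and>\<^sub>1 ed 5) xs" for xs
    by (simp add: wedge_def sum_negf)
  then show ?thesis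
    by (simp add: fun_eq_iff Omega02_def omega1_def)
qed

lemma nondeg_form_axis:
  fixes \<omega> :: "(real^'n) form"
  assumes "\<And>x. (\<And>j. \<omega> [x, axis j 1] = 0) \<Longrightarrow> x = 0"
  shows "nondeg_form \<omega>"
  using assms unfolding nondeg_form_def nondegenerate_def by blast

lemma nondeg_form_Omega: "nondeg_form Omega01" "nondeg_form Omega02"
proof -
  have "x = 0" if "\<forall>j. Omega01 [x, e j] = 0" for x
    using that unfolding forall_6 Omega01_eq
    by (simp add: omega1_apply axis_def vec_eq_iff forall_6)
  then show "nondeg_form Omega01"
    by (intro nondeg_form_axis) blast
  have "x = 0" if "\<forall>j. Omega02 [x, e j] = 0" for x
    using that unfolding forall_6 Omega02_eq
    by (simp add: omega1_apply axis_def vec_eq_iff forall_6)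
  then show "nondeg_form Omega02"
    by (intro nondeg_form_axis) blast
qed

text \<open>With \<open>w24 = w35 = 1\<close> and all other parameters zero, the form pairs
  \<open>e 1\<close> with \<open>e 6\<close>, \<open>e 2\<close> with \<open>e 4\<close> and
  \<open>e 3\<close> with \<open>e 5\<close>, so the second family has a nondegenerate
  member.\<close>

lemma nondeg_form_omega2: "nondeg_form (omega2 0 0 1 0 1)"
proof -
  have "x = 0" if "\<forall>j. omega2 0 0 1 0 1 [x, e j] = 0" for x
    using that unfolding forall_6
    by (simp add: omega2_apply axis_def vec_eq_iff forall_6)
  then show ?thesis
    by (intro nondeg_form_axis) blast
qed

theorem theorem3p3:
  shows
    "(\<nexists>\<omega>. symplectic g3 \<omega>) \<and>
     paracomplex g3 P0 \<and>
     (\<forall>\<Omega>\<in>{Omega01, Omega02}.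
        semi_para_kahler g3 \<Omega> P0 (metric_of \<Omega> P0) \<and>
        scalar_curvature g3 (metric_of \<Omega> P0) = 0) \<and>
     (\<exists>w15 w24 w25 w26 w35 w36. nondeg_form (omega1 w15 w24 w25 w26 w35 w36)) \<and>
     (\<forall>w15 w24 w25 w26 w35 w36.
        let \<omega> = omega1 w15 w24 w25 w26 w35 w36 in
        nondeg_form \<omega> \<longrightarrow>
          semi_kahler g3 \<omega> \<and> compatible \<omega> P0 \<and>
          semi_para_kahler g3 \<omega> P0 (metric_of \<omega> P0) \<and>
          scalar_curvature g3 (metric_of \<omega> P0) = 0) \<and>
     (\<exists>w14 w15 w24 w34 w35. nondeg_form (omega2 w14 w15 w24 w34 w35)) \<and>
     (\<forall>w14 w15 w24 w34 w35.
        let \<omega> = omega2 w14 w15 w24 w34 w35 in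
        nondeg_form \<omega> \<longrightarrow>
          semi_kahler g3 \<omega> \<and> compatible \<omega> P0 \<and>
          semi_para_kahler g3 \<omega> P0 (metric_of \<omega> P0) \<and>
          scalar_curvature g3 (metric_of \<omega> P0) = 0)"
proof -
  \<comment> \<open>Keeping the form as a variable with an equation lets one fact serve the whole
    family, through \<open>refl\<close>, and the forms \<open>Omega01\<close> and
    \<open>Omega02\<close>, through their descriptions as members.\<close>
  have 1: "semi_kahler g3 \<omega> \<and> compatible \<omega> P0 \<and> semi_para_kahler g3 \<omega> P0 (metric_of \<omega> P0) \<and>
      scalar_curvature g3 (metric_of \<omega> P0) = 0"
    if "nondeg_form \<omega>" "\<omega> = omega1 w15 w24 w25 w26 w35 w36" for \<omega> w15 w24 w25 w26 w35 w36
    using that is_form_omega1 compatible_omega1 closed_omega1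
      semi_para_kahler_g3[of \<omega>] scalar_curvature_g3[of \<omega>]
    by simp
  have 2: "semi_kahler g3 \<omega> \<and> compatible \<omega> P0 \<and> semi_para_kahler g3 \<omega> P0 (metric_of \<omega> P0) \<and>
      scalar_curvature g3 (metric_of \<omega> P0) = 0"
    if "nondeg_form \<omega>" "\<omega> = omega2 w14 w15 w24 w34 w35" for \<omega> w14 w15 w24 w34 w35
    using that is_form_omega2 compatible_omega2 closed_omega2
      semi_para_kahler_g3[of \<omega>] scalar_curvature_g3[of \<omega>]
    by simp
  show ?thesis
    unfolding Let_def
    using not_symplectic_g3 paracomplex_P0 1[OF nondeg_form_Omega(1) Omega01_eq]
      1[OF nondeg_form_Omega(2) Omega02_eq] 1[OF _ refl] 2[OF _ refl] nondeg_form_omega2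
      nondeg_form_Omega(1)[unfolded Omega01_eq]
    by blast
qed

end
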